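(* Every distance-regular graph is conformally rigid.
   Context: All graphs are finite, simple, undirected and connected, with vertex set $[n]=\{1,\dots,n\}$ and edge set $E$. A connected graph $G$ is distance-regular if for any two vertices $i,j$ and any $p,q\in\mathbb{N}$, the number $|\{u\in[n]: d(u,i)=p,\ d(u,j)=q\}|$ depends only on $d(i,j)$, $p$ and $q$, where $d$ is the shortest-path distance. For edge weights $w:E\to\mathbb{R}_{\ge 0}$ the weighted Laplacian $L_w\in\mathbb{R}^{n\times n}$ has $(L_w)_{ij}=-w_{ij}$ if $ij\in E$, $(L_w)_{ii}=\sum_{j\sim i}w_{ij}$, and $0$ otherwise; its eigenvalues are $0=\lambda_1(w)\le\lambda_2(w)\le\dots\le\lambda_n(w)$. Let $\mathbbm{1}$ denote the all-ones weight. A graph $G$ is conformally rigid if for all $w,w':E\to\mathbb{R}_{\ge0}$ with $\sum_{e\in E}w_e=\sum_{e\in E}w'_e=|E|$ one has $\lambda_2(w)\le\lambda_2(\mathbbm{1})\le\lambda_n(\mathbbm{1})\le\lambda_n(w')$. *)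

theory Defs
  imports "Jordan_Normal_Form.Char_Poly" "HOL-Library.Multiset"
begin

text \<open>
  A graph is given by its number of vertices \<open>n\<close> and its edge set \<open>E\<close>. The vertices are
  \<open>0, \<dots>, n - 1\<close>, matching the index convention of the matrix library. Edges are unordered
  pairs \<open>{u, v}\<close> of distinct vertices, so that loops and multiple edges are impossible.
\<close>

definition simple_graph :: "nat \<Rightarrow> nat set set \<Rightarrow> bool" where
  "simple_graph n E \<longleftrightarrow> E \<subseteq> {{u, v} | u v. u < n \<and> v < n \<and> u \<noteq> v}"

definition adj :: "nat set set \<Rightarrow> (nat \<times> nat) set" where
  "adj E = {(u, v). {u, v} \<in> E}"

definition connected_graph :: "nat \<Rightarrow> nat set set \<Rightarrow> bool" where
  "connected_graph n E \<longleftrightarrow>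
    simple_graph n E \<and> 0 < n \<and> (\<forall>u < n. \<forall>v < n. (u, v) \<in> (adj E)\<^sup>*)"

text \<open>
  \<open>(u, v) \<in> adj E ^^ k\<close> says that there is a walk of length \<open>k\<close> from \<open>u\<close> to \<open>v\<close>. The
  distance is meaningful only for vertices joined by a walk.
\<close>

definition graph_dist :: "nat set set \<Rightarrow> nat \<Rightarrow> nat \<Rightarrow> nat" where
  "graph_dist E u v = (LEAST k. (u, v) \<in> adj E ^^ k)"

definition distance_regular :: "nat \<Rightarrow> nat set set \<Rightarrow> bool" where
  "distance_regular n E \<longleftrightarrow> connected_graph n E \<and>
    (\<forall>i < n. \<forall>j < n. \<forall>i' < n. \<forall>j' < n. \<forall>p q.
      graph_dist E i j = graph_dist E i' j' \<longrightarrow>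
      card {u. u < n \<and> graph_dist E u i = p \<and> graph_dist E u j = q} =
      card {u. u < n \<and> graph_dist E u i' = p \<and> graph_dist E u j' = q})"

text \<open>Edge weights are functions on \<open>nat set\<close>; only their values on \<open>E\<close> are used.\<close>

definition laplacian :: "nat \<Rightarrow> nat set set \<Rightarrow> (nat set \<Rightarrow> real) \<Rightarrow> real mat" where
  "laplacian n E w = mat n n (\<lambda>(i, j).
     if i = j then (\<Sum>k | k < n \<and> {i, k} \<in> E. w {i, k})
     else if {i, j} \<in> E then - w {i, j}
     else 0)"

text \<open>
  The \<open>k\<close>-th smallest real eigenvalue, counted with algebraic multiplicity and from \<open>k = 1\<close>.
  Meaningful for symmetric \<open>A\<close> and \<open>1 \<le> k \<le> dim_row A\<close>: the characteristic
  polynomial then splits over the reals, so that the list has length \<open>dim_row A\<close>.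
\<close>

definition nth_eigenvalue :: "nat \<Rightarrow> real mat \<Rightarrow> real" where
  "nth_eigenvalue k A = sorted_list_of_multiset (proots (char_poly A)) ! (k - 1)"

definition lap_eigenvalue :: "nat \<Rightarrow> nat \<Rightarrow> nat set set \<Rightarrow> (nat set \<Rightarrow> real) \<Rightarrow> real" where
  "lap_eigenvalue k n E w = nth_eigenvalue k (laplacian n E w)"

definition normalized_weight :: "nat set set \<Rightarrow> (nat set \<Rightarrow> real) \<Rightarrow> bool" where
  "normalized_weight E w \<longleftrightarrow> (\<forall>e \<in> E. 0 \<le> w e) \<and> (\<Sum>e \<in> E. w e) = real (card E)"

text \<open>Meaningful for \<open>n \<ge> 2\<close> only, since a second eigenvalue is needed.\<close>

definition conformally_rigid :: "nat \<Rightarrow> nat set set \<Rightarrow> bool" where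
  "conformally_rigid n E \<longleftrightarrow>
    (\<forall>w w'. normalized_weight E w \<longrightarrow> normalized_weight E w' \<longrightarrow>
      lap_eigenvalue 2 n E w \<le> lap_eigenvalue 2 n E (\<lambda>_. 1) \<and>
      lap_eigenvalue 2 n E (\<lambda>_. 1) \<le> lap_eigenvalue n n E (\<lambda>_. 1) \<and>
      lap_eigenvalue n n E (\<lambda>_. 1) \<le> lap_eigenvalue n n E w')"

end

(*
  For a weight w of total |E| and a nonzero Laplacian eigenvalue l of the unweighted graph, take
  F to be the product of L - m I over the other eigenvalues m. By distance-regularity F(i,j) depends
  on d(i,j) only, and the columns x_j of F are l-eigenvectors orthogonal to the all-ones vector. The
  sum over j of (x_j(u) - x_j(v))^2 is the same for all edges uv, so the energy sum_j <x_j, L_w x_j>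
  depends only on the total weight and equals l * sum_j |x_j|^2. Rayleigh bounds for L_w then give
  lambda_2(w) <= l <= lambda_n(w).
*)

theory Submission
  imports Defs
begin

section \<open>Real symmetric matrices\<close>

text \<open>A single eigenvector of the unweighted Laplacian may load the edges unevenly, so a new
  weight can change its Rayleigh quotient and the vector alone need not give a bound. Averaging over
  the whole eigenspace removes this: \<open>F\<close> is a nonzero multiple of the orthogonal
  projection onto the eigenspace of \<open>l\<close>. Writing it as a polynomial in the Laplacian is
  what controls its entries, because matrices depending only on the distance are closed under
  multiplication: an entry of a product is a combination of the counts that distance-regularity
  fixes. Connectedness makes the second eigenvalue positive, so that both it and the largest one can
  serve as \<open>l\<close>. Eigenvalues are defined as sorted roots of the characteristic
  polynomial, so the Rayleigh bounds rest on a spectral theorem that keeps track of positions and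
  multiplicities.\<close>

lemma mult_vec_entry:
  assumes "A \<in> carrier_mat n m" "v \<in> carrier_vec m" "i < n"
  shows "(A *\<^sub>v v) $ i = (\<Sum>j<m. A $$ (i,j) * v $ j)"
  using assms by (auto simp: scalar_prod_def atLeast0LessThan intro!: sum.cong)

lemma mat_mult_unit_vec:
  fixes A :: "'a :: comm_semiring_1 mat"
  assumes "A \<in> carrier_mat n m" "j < m"
  shows "A *\<^sub>v unit_vec m j = col A j"
  using assms by (intro eq_vecI) auto

lemma smult_mat_mult_vec:
  fixes A :: "'a :: comm_semiring_1 mat"
  assumes "A \<in> carrier_mat n m" "v \<in> carrier_vec m"
  shows "(k \<cdot>\<^sub>m A) *\<^sub>v v = k \<cdot>\<^sub>v (A *\<^sub>v v)"
  using assms by (intro eq_vecI) auto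

lemma symmetric_entry:
  assumes "A \<in> carrier_mat n n" "A\<^sup>T = A" "i < n" "j < n"
  shows "A $$ (i,j) = A $$ (j,i)"
  using assms by (metis carrier_matD index_transpose_mat(1))

lemma symmetric_scalar_prod:
  fixes A :: "'a :: comm_semiring_0 mat"
  assumes "A \<in> carrier_mat n n" "A\<^sup>T = A" "x \<in> carrier_vec n" "y \<in> carrier_vec n"
  shows "x \<bullet> (A *\<^sub>v y) = (A *\<^sub>v x) \<bullet> y"
  using assms transpose_vec_mult_scalar[of A n n y x] comm_scalar_prod
  by (metis mult_mat_vec_carrier)

lemma self_scalar_prod:
  fixes v :: "real vec"
  assumes "v \<in> carrier_vec n"
  shows "v \<bullet> v = (\<Sum>i<n. (v $ i)\<^sup>2)"
  using assms by (auto simp: scalar_prod_def power2_eq_square atLeast0LessThan)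

lemma self_scalar_prod_pos:
  fixes v :: "real vec"
  assumes "v \<in> carrier_vec n" "v \<noteq> 0\<^sub>v n"
  shows "v \<bullet> v > 0"
proof -
  obtain i where "i < n" "v $ i \<noteq> 0"
    using assms by (metis carrier_vecD eq_vecI index_zero_vec)
  then show ?thesis
    using self_scalar_prod[OF assms(1)] by (auto intro!: sum_pos2[of _ i])
qed

section \<open>Spectral theorem for real symmetric matrices\<close>

lemma real_eigenvalue_of_symmetric:
  fixes A :: "real mat"
  assumes A: "A \<in> carrier_mat n n" and sym: "A\<^sup>T = A"
    and ev: "eigenvalue (map_mat complex_of_real A) a"
  shows "a \<in> \<real>"
proof -
  obtain v where v: "v \<in> carrier_vec n" "v \<noteq> 0\<^sub>v n"
    and Av: "map_mat complex_of_real A *\<^sub>v v = a \<cdot>\<^sub>v v"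
    using ev A unfolding eigenvalue_def eigenvector_def by auto
  \<comment> \<open>\<open>N\<close> is the Hermitian square norm of \<open>v\<close> and
    \<open>S\<close> the Hermitian form of \<open>A\<close> at \<open>v\<close>. Both are real,
    \<open>S\<close> by the symmetry of \<open>A\<close>, and \<open>S = a * N\<close> with
    \<open>N\<close> nonzero.\<close>
  define N where "N = (\<Sum>i<n. v $ i * cnj (v $ i))"
  define S where "S = (\<Sum>i<n. \<Sum>j<n. complex_of_real (A $$ (i,j)) * v $ j * cnj (v $ i))"
  have "(\<Sum>j<n. complex_of_real (A $$ (i,j)) * v $ j) = a * v $ i" if "i < n" for i
  proof -
    have "a * v $ i = (\<Sum>j<n. map_mat complex_of_real A $$ (i,j) * v $ j)"
      using mult_vec_entry[of "map_mat complex_of_real A" n n v i] A v that Av by simp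
    also have "\<dots> = (\<Sum>j<n. complex_of_real (A $$ (i,j)) * v $ j)"
      by (rule sum.cong) (use A that in auto)
    finally show ?thesis ..
  qed
  then have "S = (\<Sum>i<n. a * v $ i * cnj (v $ i))"
    unfolding S_def by (simp add: sum_distrib_right[symmetric])
  then have SN: "S = a * N"
    by (simp add: N_def sum_distrib_left mult.assoc)
  have N_real: "N = complex_of_real (\<Sum>i<n. (cmod (v $ i))\<^sup>2)"
    by (simp add: N_def complex_norm_square del: of_real_power)
  obtain i where "i < n" "v $ i \<noteq> 0"
    using v by (metis carrier_vecD eq_vecI index_zero_vec)
  then have "(\<Sum>i<n. (cmod (v $ i))\<^sup>2) > 0"
    by (auto intro!: sum_pos2[of _ i])
  then have "N \<noteq> 0"
    unfolding N_real by (metis of_real_eq_0_iff less_irrefl)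
  have "cnj S = (\<Sum>i<n. \<Sum>j<n. complex_of_real (A $$ (i,j)) * cnj (v $ j) * v $ i)"
    by (simp add: S_def)
  also have "\<dots> = (\<Sum>j<n. \<Sum>i<n. complex_of_real (A $$ (j,i)) * v $ i * cnj (v $ j))"
    by (subst sum.swap) (auto intro!: sum.cong simp: symmetric_entry[OF A sym])
  finally have "cnj S = S"
    by (simp add: S_def)
  moreover have "cnj N = N"
    by (simp add: N_real)
  ultimately have "cnj a = a"
    using SN \<open>N \<noteq> 0\<close> by auto
  then show ?thesis
    by (simp add: Reals_cnj_iff)
qed

text \<open>The complex factorization has only real roots, so it is the image of a real product, and
  the embedding of real polynomials is injective.\<close>

lemma char_poly_symmetric_splits:
  fixes A :: "real mat"
  assumes A: "A \<in> carrier_mat n n" and sym: "A\<^sup>T = A"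
  obtains es where "char_poly A = (\<Prod>e\<leftarrow>es. [:- e, 1:])" "length es = n"
proof -
  interpret p: map_poly_inj_comm_ring_hom complex_of_real ..
  let ?B = "map_mat complex_of_real A"
  have B: "?B \<in> carrier_mat n n"
    using A by simp
  obtain as where as: "char_poly ?B = (\<Prod>a\<leftarrow>as. [:- a, 1:])" "length as = n"
    using char_poly_factorized[OF B] by blast
  have real: "a \<in> \<real>" if "a \<in> set as" for a
  proof -
    have "poly (char_poly ?B) a = 0"
      unfolding as(1) using that by (force simp: poly_prod_list prod_list_zero_iff)
    then show ?thesis
      using real_eigenvalue_of_symmetric[OF A sym] eigenvalue_root_char_poly[OF B] by blast
  qed
  have "map_poly complex_of_real (\<Prod>e\<leftarrow>map Re as. [:- e, 1:]) = (\<Prod>a\<leftarrow>as. [:- a, 1:])"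
    using real
  proof (induction as)
    case (Cons a as)
    have "map_poly complex_of_real [:- Re a, 1:] = [:- a, 1:]"
      using Cons.prems[of a] by simp
    then show ?case
      using Cons by (simp only: list.map prod_list.Cons p.hom_mult list.set_intros)
  qed simp
  also have "\<dots> = map_poly complex_of_real (char_poly A)"
    unfolding as(1)[symmetric] by (rule of_real_hom.char_poly_hom[OF A])
  finally have "(\<Prod>e\<leftarrow>map Re as. [:- e, 1:]) = char_poly A"
    by (rule p.injectivity)
  then show thesis
    using that[of "map Re as"] as(2) by simp
qed

text \<open>The matrix \<open>H\<close> is the Householder reflection exchanging \<open>u\<close> and the first unit vector.
  If these coincide then \<open>c = 2 / 0 = 0\<close>, and \<open>H\<close> is the identity.\<close>
lemma householder:
  fixes u :: "real vec"
  assumes u: "u \<in> carrier_vec n" and unit: "u \<bullet> u = 1" and n: "0 < n"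
  obtains H where "H \<in> carrier_mat n n" "H\<^sup>T = H" "H * H = 1\<^sub>m n"
    "H *\<^sub>v u = unit_vec n 0" "H *\<^sub>v unit_vec n 0 = u"
proof -
  define w where "w = u - unit_vec n 0"
  define c where "c = 2 / (w \<bullet> w)"
  define H where "H = mat n n (\<lambda>(i,j). (if i = j then 1 else 0) - c * w $ i * w $ j)"
  have w: "w \<in> carrier_vec n" and H: "H \<in> carrier_mat n n"
    using u by (auto simp: w_def H_def)
  have Hx: "H *\<^sub>v x = x - (c * (w \<bullet> x)) \<cdot>\<^sub>v w" if x: "x \<in> carrier_vec n" for x
  proof (rule eq_vecI)
    fix i assume "i < dim_vec (x - (c * (w \<bullet> x)) \<cdot>\<^sub>v w)"
    then have i: "i < n"
      using w x by simp
    have "(H *\<^sub>v x) $ i = (\<Sum>j<n. (if i = j then x $ j else 0) - c * w $ i * (w $ j * x $ j))"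
      by (subst mult_vec_entry[OF H x i], rule sum.cong) (use i in \<open>auto simp: H_def algebra_simps\<close>)
    also have "\<dots> = x $ i - c * w $ i * (w \<bullet> x)"
      using i x by (simp add: sum_subtractf sum_distrib_left scalar_prod_def atLeast0LessThan)
    finally show "(H *\<^sub>v x) $ i = (x - (c * (w \<bullet> x)) \<cdot>\<^sub>v w) $ i"
      using i w x by (simp add: mult_ac)
  qed (use w x H in auto)
  \<comment> \<open>In \<open>H * H\<close> the rank-one part \<open>w $ i * w $ j\<close> gets the
    coefficient \<open>c * c * (w \<bullet> w) - 2 * c\<close>. It vanishes also for
    \<open>w \<bullet> w = 0\<close>, where \<open>c = 0\<close>.\<close>
  have cw: "c * c * (w \<bullet> w) = 2 * c"
    by (simp add: c_def)
  have "H * H = 1\<^sub>m n"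
  proof (rule eq_matI)
    fix i j assume "i < dim_row (1\<^sub>m n)" "j < dim_col (1\<^sub>m n)"
    then have ij: "i < n" "j < n"
      by auto
    have "(H * H) $$ (i,j) = (H *\<^sub>v col H j) $ i"
      using ij H by simp
    also have "\<dots> = H $$ (i,j) - c * (w \<bullet> col H j) * w $ i"
      using ij H w by (subst Hx) auto
    also have "w \<bullet> col H j = (\<Sum>k<n. (if k = j then w $ k else 0) - c * w $ j * (w $ k * w $ k))"
      unfolding scalar_prod_def atLeast0LessThan
      by (rule sum.cong) (use ij H w in \<open>auto simp: H_def algebra_simps\<close>)
    also have "\<dots> = w $ j - c * w $ j * (w \<bullet> w)"
      using ij w by (simp add: sum_subtractf sum_distrib_left scalar_prod_def atLeast0LessThan)
    also have "H $$ (i,j) - c * (w $ j - c * w $ j * (w \<bullet> w)) * w $ i =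
        H $$ (i,j) + (c * c * (w \<bullet> w)) * w $ i * w $ j - c * w $ i * w $ j"
      by (simp add: algebra_simps)
    also have "\<dots> = H $$ (i,j) + c * w $ i * w $ j"
      unfolding cw by simp
    finally show "(H * H) $$ (i,j) = 1\<^sub>m n $$ (i,j)"
      using ij by (simp add: H_def)
  qed (use H in auto)
  moreover have "H\<^sup>T = H"
    by (rule eq_matI) (auto simp: H_def)
  moreover have Hu: "H *\<^sub>v u = unit_vec n 0"
  proof -
    \<comment> \<open>Both vectors have length one, so each side is 2 minus twice their scalar
      product. Hence \<open>c * (w \<bullet> u) = 1\<close> for nonzero \<open>w\<close>, and the
      reflection sends \<open>u\<close> to \<open>u - w\<close>.\<close>
    have ww: "w \<bullet> w = 2 * (w \<bullet> u)"
      using u n unit by (simp add: w_def minus_scalar_prod_distrib[of _ n] scalar_prod_minus_distrib[of _ n])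
    have eq: "u - (c * (w \<bullet> u)) \<cdot>\<^sub>v w = unit_vec n 0"
    proof (cases "w \<bullet> w = 0")
      case True
      then have "w = 0\<^sub>v n"
        using self_scalar_prod_pos[OF w] by auto
      then have "u - unit_vec n 0 = 0\<^sub>v n"
        by (simp add: w_def)
      then have "(u - unit_vec n 0) $ i = 0" if "i < n" for i
        using that by simp
      then have "u $ i = unit_vec n 0 $ i" if "i < n" for i
        using that u by (simp del: index_unit_vec(1))
      then show ?thesis
        using \<open>w = 0\<^sub>v n\<close> u by (intro eq_vecI) auto
    next
      case False
      then have "c * (w \<bullet> u) = 1"
        by (simp add: c_def ww)
      then show ?thesis
        using u by (intro eq_vecI) (auto simp: w_def)
    qed
    show ?thesis
      by (simp only: Hx[OF u] eq)
  qed
  moreover have "H *\<^sub>v unit_vec n 0 = u"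
    unfolding Hu[symmetric] using \<open>H * H = 1\<^sub>m n\<close> H u
    by (metis assoc_mult_mat_vec one_mult_mat_vec)
  ultimately show thesis
    using that H by blast
qed

text \<open>Deflation: a reflection moves a unit eigenvector to the first unit vector; by symmetry
  the conjugated matrix then splits off a 1 by 1 block, and induction treats the rest. The
  factorization is a hypothesis so that the order of the eigenvalues can be prescribed, in
  particular sorted.\<close>

lemma symmetric_diagonalization:
  fixes A :: "real mat"
  assumes "A \<in> carrier_mat n n" "A\<^sup>T = A" "char_poly A = (\<Prod>e\<leftarrow>es. [:- e, 1:])" "length es = n"
  shows "\<exists>U \<in> carrier_mat n n. U\<^sup>T * U = 1\<^sub>m n \<and> A * U = U * mat_diag n ((!) es)"
  using assms
proof (induction es arbitrary: A n)
  case Nil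
  then show ?case
    by (intro bexI[of _ "1\<^sub>m 0"]) (auto simp: mat_diag_def intro!: eq_matI)
next
  case (Cons e es)
  define m where "m = length es"
  have n: "n = Suc m"
    using Cons.prems by (simp add: m_def)
  note A = Cons.prems(1) and sym = Cons.prems(2)
  have "poly (char_poly A) e = 0"
    by (simp add: Cons.prems)
  then obtain v where v: "v \<in> carrier_vec n" "v \<noteq> 0\<^sub>v n" "A *\<^sub>v v = e \<cdot>\<^sub>v v"
    using eigenvalue_root_char_poly[OF A] A unfolding eigenvalue_def eigenvector_def by auto
  define u where "u = (1 / sqrt (v \<bullet> v)) \<cdot>\<^sub>v v"
  have u: "u \<in> carrier_vec n" and Au: "A *\<^sub>v u = e \<cdot>\<^sub>v u"
    using v A by (auto simp: u_def mult_mat_vec[of _ n n] smult_smult_assoc mult.commute)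
  have uu: "u \<bullet> u = 1"
    using v(1) self_scalar_prod_pos[OF v(1,2)] by (simp add: u_def)
  obtain H where H: "H \<in> carrier_mat n n" "H\<^sup>T = H" "H * H = 1\<^sub>m n"
    "H *\<^sub>v u = unit_vec n 0" "H *\<^sub>v unit_vec n 0 = u"
    using householder[OF u uu] n by auto
  define B where "B = H * A * H"
  have B: "B \<in> carrier_mat n n"
    using H A by (simp add: B_def)
  have Bsym: "B\<^sup>T = B"
    using H A sym by (simp add: B_def transpose_mult[of _ n n _ n] assoc_mult_mat[of _ n n _ n _ n])
  have "B *\<^sub>v unit_vec n 0 = e \<cdot>\<^sub>v unit_vec n 0"
    using H A u Au by (simp add: B_def assoc_mult_mat_vec[of _ n n _ n] mult_mat_vec[of _ n n])
  then have "col B 0 = e \<cdot>\<^sub>v unit_vec n 0"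
    using B n mat_mult_unit_vec[OF B, of 0] by simp
  then have col0: "B $$ (i,0) = (if i = 0 then e else 0)" if "i < n" for i
    using that B n by (metis carrier_matD index_col index_smult_vec(1) index_unit_vec(1,3)
        mult.right_neutral mult_zero_right zero_less_Suc)
  define D where "D = mat m m (\<lambda>(i,j). B $$ (Suc i, Suc j))"
  have D: "D \<in> carrier_mat m m"
    by (simp add: D_def)
  have Dsym: "D\<^sup>T = D"
    by (rule eq_matI) (use symmetric_entry[OF B Bsym] n in \<open>auto simp: D_def\<close>)
  have row0: "B $$ (0,j) = (if j = 0 then e else 0)" if "j < n" for j
    using that col0 symmetric_entry[OF B Bsym, of 0 j] n by auto
  have block: "B = four_block_mat (mat 1 1 (\<lambda>_. e)) (0\<^sub>m 1 m) (0\<^sub>m m 1) D"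
    by (rule eq_matI) (use B n in \<open>auto simp: D_def row0 col0\<close>)
  \<comment> \<open>\<open>H\<close> is its own inverse. Similarity preserves the characteristic
    polynomial, and cancelling the factor of \<open>e\<close> leaves the factorization of
    \<open>char_poly D\<close> that the induction hypothesis asks for.\<close>
  have "similar_mat_wit A B H H"
    by (rule similar_mat_witI[of _ _ n])
      (use A B H in \<open>auto simp: B_def assoc_mult_mat[of _ n n _ n _ n]\<close>,
       metis A H(1,3) assoc_mult_mat left_mult_one_mat mult_carrier_mat right_mult_one_mat)
  then have "char_poly A = char_poly B"
    using char_poly_similar similar_mat_def by blast
  also have "\<dots> = [:- e, 1:] * char_poly D"
    unfolding block by (subst char_poly_four_block_zeros_col) (use D in \<open>auto simp: char_poly_defs det_single\<close>)
  finally have "[:- e, 1:] * char_poly D = [:- e, 1:] * (\<Prod>e\<leftarrow>es. [:- e, 1:])"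
    using Cons.prems(3) by simp
  then have "char_poly D = (\<Prod>e\<leftarrow>es. [:- e, 1:])"
    by (metis mult_cancel_left one_neq_zero pCons_eq_0_iff)
  then obtain V where V: "V \<in> carrier_mat m m" "V\<^sup>T * V = 1\<^sub>m m" "D * V = V * mat_diag m ((!) es)"
    using Cons.IH[OF D Dsym] m_def by blast
  \<comment> \<open>Bordering \<open>V\<close> by 1 diagonalizes \<open>B\<close>; the reflection
    then carries this basis back to one for \<open>A\<close>.\<close>
  define W where "W = four_block_mat (1\<^sub>m 1) (0\<^sub>m 1 m) (0\<^sub>m m 1) V"
  have W: "W \<in> carrier_mat n n"
    using V four_block_carrier_mat[of "1\<^sub>m 1" 1 1 V m m] n by (simp add: W_def)
  have diag: "mat_diag n ((!) (e # es)) =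
      four_block_mat (mat 1 1 (\<lambda>_. e)) (0\<^sub>m 1 m) (0\<^sub>m m 1) (mat_diag m ((!) es))"
    by (rule eq_matI) (use n in \<open>auto simp: mat_diag_def nth_Cons'\<close>)
  have md: "mat_diag m ((!) es) \<in> carrier_mat m m"
    by simp
  have WW: "W\<^sup>T * W = 1\<^sub>m n"
    unfolding W_def using V n
    by (subst transpose_four_block_mat[of _ 1 1 _ m _ m])
      (auto simp: mult_four_block_mat[of _ 1 1 _ m _ m _ _ 1 _ m])
  have BW: "B * W = W * mat_diag n ((!) (e # es))"
    unfolding W_def diag block using V D md n
    by (subst (1 2) mult_four_block_mat[of _ 1 1 _ m _ m _ _ 1 _ m]) (auto simp: left_mult_zero_mat[OF md] intro!: cong_four_block_mat)
  have HHW: "H * (H * W) = W"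
    using H W by (metis assoc_mult_mat left_mult_one_mat)
  have 1: "(H * W)\<^sup>T * (H * W) = 1\<^sub>m n"
    using H W by (simp add: transpose_mult[of _ n n _ n] assoc_mult_mat[of _ n n _ n _ n] HHW WW)
  have "H * B = A * H"
  proof -
    have "H * B = (H * H) * (A * H)"
      using H(1) A by (simp add: B_def assoc_mult_mat[of _ n n _ n _ n])
    then show ?thesis
      using H(1,3) A by (metis left_mult_one_mat mult_carrier_mat)
  qed
  then have "A * (H * W) = H * (B * W)"
    using assoc_mult_mat[OF A H(1) W] assoc_mult_mat[OF H(1) B W] by simp
  also have "\<dots> = (H * W) * mat_diag n ((!) (e # es))"
    unfolding BW by (rule assoc_mult_mat[OF H(1) W mat_diag_dim, symmetric])
  finally show ?case
    using 1 H(1) W by (intro bexI[of _ "H * W"] conjI) (assumption | rule mult_carrier_mat)+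
qed

text \<open>The columns of \<open>U\<close> are an orthonormal eigenbasis in increasing order of
  eigenvalue. List positions start at 0, so \<open>es ! 1\<close> is the second eigenvalue and
  \<open>es ! (n - 1)\<close> the largest.\<close>

locale eigenbasis =
  fixes n :: nat and A U :: "real mat" and es :: "real list"
  assumes A: "A \<in> carrier_mat n n" and sym: "A\<^sup>T = A"
    and U: "U \<in> carrier_mat n n" and orth: "U\<^sup>T * U = 1\<^sub>m n"
    and diag: "A * U = U * mat_diag n ((!) es)"
    and len: "length es = n" and sorted: "sorted es"
    and nth_eigenvalue: "\<And>k. nth_eigenvalue k A = es ! (k - 1)"

lemma ex_eigenbasis:
  fixes A :: "real mat"
  assumes A: "A \<in> carrier_mat n n" and sym: "A\<^sup>T = A"
  obtains U es where "eigenbasis n A U es"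
proof -
  obtain ds where ds: "char_poly A = (\<Prod>e\<leftarrow>ds. [:- e, 1:])" "length ds = n"
    using char_poly_symmetric_splits[OF A sym] .
  define es where "es = sort ds"
  have "(\<Prod>e\<leftarrow>es. [:- e, 1:]) = prod_mset (image_mset (\<lambda>e. [:- e, 1:]) (mset es))"
    by (metis mset_map prod_mset_prod_list)
  also have "\<dots> = (\<Prod>e\<leftarrow>ds. [:- e, 1:])"
    unfolding es_def mset_sort by (metis mset_map prod_mset_prod_list)
  finally have es: "char_poly A = (\<Prod>e\<leftarrow>es. [:- e, 1:])" "length es = n" "sorted es"
    using ds by (simp_all add: es_def)
  obtain U where U: "U \<in> carrier_mat n n" "U\<^sup>T * U = 1\<^sub>m n" "A * U = U * mat_diag n ((!) es)"
    using symmetric_diagonalization[OF A sym es(1,2)] by blast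
  \<comment> \<open>This identifies the diagonal entries, with multiplicity, with the root multiset
    by which \<open>nth_eigenvalue\<close> is defined.\<close>
  have "proots (\<Prod>e\<leftarrow>xs. [:- e, 1:]) = mset xs" for xs :: "real list"
  proof (induction xs)
    case (Cons x xs)
    have "(\<Prod>e\<leftarrow>xs. [:- e, 1:]) \<noteq> 0"
      by (auto simp: prod_list_zero_iff)
    then have "proots ([:- x, 1:] * (\<Prod>e\<leftarrow>xs. [:- e, 1:])) = add_mset x (mset xs)"
      by (subst proots_mult) (auto simp: Cons)
    then show ?case
      by simp
  qed simp
  then have "sorted_list_of_multiset (proots (char_poly A)) = es"
    using es sorted_list_of_multiset_mset[of es] by (simp add: sorted_sort_id)
  then show thesis
    using that A sym U es by (auto simp: eigenbasis_def nth_eigenvalue_def)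
qed

section \<open>Rayleigh bounds and projections onto eigenspaces\<close>

context eigenbasis
begin

lemma orth': "U * U\<^sup>T = 1\<^sub>m n"
  using mat_mult_left_right_inverse[of "U\<^sup>T" n U] U orth by simp

lemma col_carrier: "i < n \<Longrightarrow> col U i \<in> carrier_vec n"
  using U by simp

lemma eigenvector_col:
  assumes "i < n"
  shows "A *\<^sub>v col U i = es ! i \<cdot>\<^sub>v col U i"
proof -
  have "A *\<^sub>v col U i = col (U * mat_diag n ((!) es)) i"
    using A U by (simp only: diag[symmetric] col_mult2[OF A U assms])
  also have "\<dots> = es ! i \<cdot>\<^sub>v col U i"
    using assms U by (intro eq_vecI) (auto simp: mat_diag_mult_right)
  finally show ?thesis .
qed

lemma col_orthonormal:
  assumes "i < n" "j < n"
  shows "col U i \<bullet> col U j = (if i = j then 1 else 0)"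
proof -
  have "col U i \<bullet> col U j = (U\<^sup>T * U) $$ (i,j)"
    using assms U by simp
  then show ?thesis
    using assms by (simp add: orth)
qed

lemma mat_eq_on_basis:
  assumes "M \<in> carrier_mat n n" "N \<in> carrier_mat n n"
    and "\<And>i. i < n \<Longrightarrow> M *\<^sub>v col U i = N *\<^sub>v col U i"
  shows "M = N"
proof -
  have "M * U = N * U"
    by (rule mat_col_eqI)
      (use assms U in \<open>auto simp: col_mult2[OF assms(1) U] col_mult2[OF assms(2) U] simp del: col_mult\<close>)
  then have "M * (U * U\<^sup>T) = N * (U * U\<^sup>T)"
    using assoc_mult_mat[OF assms(1) U, of "U\<^sup>T" n] assoc_mult_mat[OF assms(2) U, of "U\<^sup>T" n] U
    by simp
  then show ?thesis
    using assms by (simp add: orth')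
qed

lemma parseval:
  assumes x: "x \<in> carrier_vec n" and y: "y \<in> carrier_vec n"
  shows "x \<bullet> y = (\<Sum>i<n. (col U i \<bullet> x) * (col U i \<bullet> y))"
proof -
  have "x = U *\<^sub>v (U\<^sup>T *\<^sub>v x)"
    using x U by (metis assoc_mult_mat_vec one_mult_mat_vec orth' transpose_carrier_mat)
  then have "x \<bullet> y = (U *\<^sub>v (U\<^sup>T *\<^sub>v x)) \<bullet> y"
    by simp
  also have "\<dots> = (U\<^sup>T *\<^sub>v x) \<bullet> (U\<^sup>T *\<^sub>v y)"
    using transpose_vec_mult_scalar[of "U\<^sup>T" n n y "U\<^sup>T *\<^sub>v x"] x y U by simp
  also have "\<dots> = (\<Sum>i<n. (col U i \<bullet> x) * (col U i \<bullet> y))"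
    using U unfolding scalar_prod_def[of "U\<^sup>T *\<^sub>v x"] atLeast0LessThan
    by (auto intro!: sum.cong)
  finally show ?thesis .
qed

lemma quadratic_form:
  assumes x: "x \<in> carrier_vec n"
  shows "x \<bullet> (A *\<^sub>v x) = (\<Sum>i<n. es ! i * (col U i \<bullet> x)\<^sup>2)"
proof -
  have "col U i \<bullet> (A *\<^sub>v x) = es ! i * (col U i \<bullet> x)" if "i < n" for i
    using symmetric_scalar_prod[OF A sym col_carrier[OF that] x] eigenvector_col[OF that]
      col_carrier[OF that] x by simp
  then show ?thesis
    using parseval[OF x, of "A *\<^sub>v x"] A x by (simp add: power2_eq_square mult_ac)
qed

lemma self_scalar_prod_basis:
  "x \<in> carrier_vec n \<Longrightarrow> x \<bullet> x = (\<Sum>i<n. (col U i \<bullet> x)\<^sup>2)"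
  by (simp add: parseval[of x x] power2_eq_square)

lemma nth_mono: "i \<le> j \<Longrightarrow> j < n \<Longrightarrow> es ! i \<le> es ! j"
  using sorted len by (simp add: sorted_nth_mono)

lemma rayleigh_col: "i < n \<Longrightarrow> col U i \<bullet> (A *\<^sub>v col U i) = es ! i"
  using eigenvector_col[of i] col_orthonormal[of i i] col_carrier[of i] by simp

lemma rayleigh_upper:
  assumes x: "x \<in> carrier_vec n"
  shows "x \<bullet> (A *\<^sub>v x) \<le> es ! (n - 1) * (x \<bullet> x)"
  unfolding quadratic_form[OF x] self_scalar_prod_basis[OF x] sum_distrib_left
  by (rule sum_mono) (auto intro!: mult_right_mono nth_mono)

text \<open>If \<open>es ! 1 > 0\<close> then the kernel is spanned by the first basis vector, so that \<open>x\<close> has no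
  component there; otherwise positive semidefiniteness is enough.\<close>
lemma rayleigh_lower:
  assumes psd: "\<And>y. y \<in> carrier_vec n \<Longrightarrow> 0 \<le> y \<bullet> (A *\<^sub>v y)"
    and z: "z \<in> carrier_vec n" "z \<noteq> 0\<^sub>v n" "A *\<^sub>v z = 0\<^sub>v n"
    and x: "x \<in> carrier_vec n" "x \<bullet> z = 0" and n: "2 \<le> n"
  shows "es ! 1 * (x \<bullet> x) \<le> x \<bullet> (A *\<^sub>v x)"
proof (cases "es ! 1 > 0")
  case False
  then show ?thesis
    using psd[OF x(1)] self_scalar_prod[OF x(1)] mult_nonpos_nonneg[of "es ! 1" "x \<bullet> x"]
    by (force simp: sum_nonneg)
next
  case True
  have ortho: "col U i \<bullet> z = 0" if "i < n" "i \<noteq> 0" for i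
  proof -
    have "es ! i * (col U i \<bullet> z) = (A *\<^sub>v col U i) \<bullet> z"
      using eigenvector_col[OF that(1)] col_carrier[OF that(1)] z by simp
    also have "\<dots> = 0"
      using symmetric_scalar_prod[OF A sym col_carrier[OF that(1)] z(1)] z col_carrier[OF that(1)]
      by simp
    finally show ?thesis
      using True nth_mono[of 1 i] that by auto
  qed
  \<comment> \<open>All other components of \<open>z\<close> vanish, so Parseval reduces a product
    with \<open>z\<close> to one term; \<open>x \<bullet> z = 0\<close> then kills the component of
    \<open>x\<close> along the first basis vector.\<close>
  have only0: "(\<Sum>i<n. (col U i \<bullet> y) * (col U i \<bullet> z)) = (col U 0 \<bullet> y) * (col U 0 \<bullet> z)" for y
    using n by (subst sum.mono_neutral_right[of _ "{0}"]) (auto simp: ortho)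
  have "col U 0 \<bullet> z \<noteq> 0"
    using self_scalar_prod_pos[OF z(1,2)] parseval[OF z(1) z(1)] only0[of z] by auto
  then have "col U 0 \<bullet> x = 0"
    using parseval[OF x(1) z(1)] only0[of x] x(2) by simp
  then have "es ! 1 * (col U i \<bullet> x)\<^sup>2 \<le> es ! i * (col U i \<bullet> x)\<^sup>2" if "i < n" for i
    using nth_mono[of 1 i] that by (cases "i = 0") (auto intro!: mult_right_mono)
  then show ?thesis
    unfolding quadratic_form[OF x(1)] self_scalar_prod_basis[OF x(1)] sum_distrib_left
    by (intro sum_mono) simp
qed

text \<open>The matrix \<open>F\<close> is the product of \<open>A - \<mu> I\<close> over the eigenvalues \<open>\<mu>\<close> other than \<open>l\<close>.\<close>
lemma eigenspace_polynomial:
  assumes one: "P (1\<^sub>m n)"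
    and step: "\<And>M \<mu>. M \<in> carrier_mat n n \<Longrightarrow> P M \<Longrightarrow> P ((A - \<mu> \<cdot>\<^sub>m 1\<^sub>m n) * M)"
    and l: "l \<in> set es"
  obtains F where "F \<in> carrier_mat n n" "P F" "A * F = l \<cdot>\<^sub>m F" "F \<noteq> 0\<^sub>m n n"
proof -
  \<comment> \<open>For any list of roots the product of the factors acts on each basis vector as a
    scalar. Building it by left multiplication carries the invariant \<open>P\<close> along.\<close>
  have "\<exists>F \<in> carrier_mat n n. P F \<and>
    (\<forall>i<n. F *\<^sub>v col U i = (\<Prod>\<mu>\<leftarrow>ms. es ! i - \<mu>) \<cdot>\<^sub>v col U i)" for ms
  proof (induction ms)
    case Nil
    then show ?case
      using one U by (intro bexI[of _ "1\<^sub>m n"]) auto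
  next
    case (Cons m ms)
    then obtain F where F: "F \<in> carrier_mat n n" "P F"
      and Fcol: "\<And>i. i < n \<Longrightarrow> F *\<^sub>v col U i = (\<Prod>\<mu>\<leftarrow>ms. es ! i - \<mu>) \<cdot>\<^sub>v col U i"
      by blast
    have B: "A - m \<cdot>\<^sub>m 1\<^sub>m n \<in> carrier_mat n n"
      by (rule minus_carrier_mat) simp
    have "((A - m \<cdot>\<^sub>m 1\<^sub>m n) * F) *\<^sub>v col U i = (\<Prod>\<mu>\<leftarrow>m # ms. es ! i - \<mu>) \<cdot>\<^sub>v col U i"
      if i: "i < n" for i
    proof -
      have "(A - m \<cdot>\<^sub>m 1\<^sub>m n) *\<^sub>v col U i = (es ! i - m) \<cdot>\<^sub>v col U i"
        using A col_carrier[OF i] eigenvector_col[OF i]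
        by (intro eq_vecI)
          (auto simp: minus_mult_distrib_mat_vec[of _ n n] smult_mat_mult_vec[of _ n n] left_diff_distrib
            simp del: index_mult_mat_vec)
      then show ?thesis
        using B F col_carrier[OF i]
        by (simp add: assoc_mult_mat_vec[of _ n n _ n] Fcol[OF i] mult_mat_vec[of _ n n] smult_smult_assoc mult.commute)
    qed
    then show ?case
      using B F step[OF F] by (intro bexI[of _ "(A - m \<cdot>\<^sub>m 1\<^sub>m n) * F"]) auto
  qed
  \<comment> \<open>The filter keeps repeated eigenvalues repeated, which rescales \<open>F\<close>
    by a nonzero factor only. The scalar is zero for eigenvalues other than \<open>l\<close>, each
    being among the roots, and nonzero for \<open>l\<close>.\<close>
  from this[of "filter (\<lambda>\<mu>. \<mu> \<noteq> l) es"] obtain F where F: "F \<in> carrier_mat n n" "P F"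
    and Fcol: "\<And>i. i < n \<Longrightarrow>
      F *\<^sub>v col U i = (\<Prod>\<mu>\<leftarrow>filter (\<lambda>\<mu>. \<mu> \<noteq> l) es. es ! i - \<mu>) \<cdot>\<^sub>v col U i"
    by blast
  have "A * F = l \<cdot>\<^sub>m F"
  proof (rule mat_eq_on_basis)
    fix i assume i: "i < n"
    define c where "c = (\<Prod>\<mu>\<leftarrow>filter (\<lambda>\<mu>. \<mu> \<noteq> l) es. es ! i - \<mu>)"
    have "c = 0" if "es ! i \<noteq> l"
      using that i len unfolding c_def prod_list_zero_iff by force
    then have "c * es ! i = l * c"
      by auto
    then have "(c * es ! i) \<cdot>\<^sub>v col U i = (l * c) \<cdot>\<^sub>v col U i"
      by (rule arg_cong)
    then show "(A * F) *\<^sub>v col U i = (l \<cdot>\<^sub>m F) *\<^sub>v col U i"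
      using A F col_carrier[OF i] eigenvector_col[OF i] Fcol[OF i, folded c_def]
      by (simp add: assoc_mult_mat_vec[of _ n n _ n] mult_mat_vec[of _ n n] smult_smult_assoc
          smult_mat_mult_vec[of _ n n])
  qed (use A F in auto)
  moreover have "F \<noteq> 0\<^sub>m n n"
  proof
    assume F0: "F = 0\<^sub>m n n"
    obtain i where i: "i < n" "es ! i = l"
      using l len by (metis in_set_conv_nth)
    define c where "c = (\<Prod>\<mu>\<leftarrow>filter (\<lambda>\<mu>. \<mu> \<noteq> l) es. es ! i - \<mu>)"
    have "c \<noteq> 0"
      using i unfolding c_def prod_list_zero_iff by force
    have "c * (col U i \<bullet> col U i) = col U i \<bullet> (F *\<^sub>v col U i)"
      using Fcol[OF i(1), folded c_def] col_carrier[OF i(1)] by simp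
    also have "F *\<^sub>v col U i = 0\<^sub>v n"
      unfolding F0 by (rule eq_vecI) (use col_carrier[OF i(1)] in auto)
    finally show False
      using \<open>c \<noteq> 0\<close> col_orthonormal[OF i(1) i(1)] col_carrier[OF i(1)] by simp
  qed
  ultimately show thesis
    using that F by blast
qed

end

section \<open>Graph distance\<close>

lemma adj_iff: "(u, v) \<in> adj E \<longleftrightarrow> {u, v} \<in> E"
  by (simp add: adj_def)

lemma relpow_adj_sym: "(u, v) \<in> adj E ^^ k \<Longrightarrow> (v, u) \<in> adj E ^^ k"
proof (induction k arbitrary: v)
  case (Suc k)
  then obtain x where "(u, x) \<in> adj E ^^ k" "(x, v) \<in> adj E"
    by auto
  then show ?case
    using Suc.IH relpow_Suc_I2[of v x "adj E" u k] by (simp only: adj_iff insert_commute)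
qed simp

lemma graph_dist_sym: "graph_dist E u v = graph_dist E v u"
  unfolding graph_dist_def using relpow_adj_sym by metis

text \<open>Connectedness makes the set under \<open>LEAST\<close> nonempty, so the minimum is
  attained.\<close>

lemma walk_graph_dist:
  assumes "connected_graph n E" "u < n" "v < n"
  shows "(u, v) \<in> adj E ^^ graph_dist E u v"
  unfolding graph_dist_def
  by (rule LeastI_ex) (use assms in \<open>auto simp: connected_graph_def dest: rtrancl_imp_relpow\<close>)

lemma graph_dist_eq_0_iff:
  assumes "connected_graph n E" "u < n" "v < n"
  shows "graph_dist E u v = 0 \<longleftrightarrow> u = v"
proof
  show "graph_dist E u v = 0 \<Longrightarrow> u = v"
    using walk_graph_dist[OF assms] by auto
  show "u = v \<Longrightarrow> graph_dist E u v = 0"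
    by (auto simp: graph_dist_def intro!: Least_equality)
qed

lemma no_loop: "simple_graph n E \<Longrightarrow> {u} \<notin> E"
  by (force simp: simple_graph_def)

lemma graph_dist_eq_1_iff:
  assumes "connected_graph n E" "u < n" "v < n"
  shows "graph_dist E u v = 1 \<longleftrightarrow> {u, v} \<in> E"
proof
  show "graph_dist E u v = 1 \<Longrightarrow> {u, v} \<in> E"
    using walk_graph_dist[OF assms] by (auto simp: adj_iff)
next
  assume e: "{u, v} \<in> E"
  then have "(u, v) \<in> adj E ^^ 1"
    by (simp add: adj_iff)
  then have "graph_dist E u v \<le> 1"
    unfolding graph_dist_def by (rule Least_le)
  moreover have "u \<noteq> v"
    using e no_loop assms by (auto simp: connected_graph_def)
  ultimately show "graph_dist E u v = 1"
    using graph_dist_eq_0_iff[OF assms] by linarith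
qed

text \<open>Equal fibre sizes mean that both maps produce the same multiset of values on
  \<open>S\<close>.\<close>

lemma sum_cong_fibre_card:
  fixes f :: "'b \<Rightarrow> 'c :: comm_monoid_add"
  assumes "finite S" "\<And>y. card {x \<in> S. \<phi> x = y} = card {x \<in> S. \<psi> x = y}"
  shows "(\<Sum>x\<in>S. f (\<phi> x)) = (\<Sum>x\<in>S. f (\<psi> x))"
proof -
  have "image_mset \<phi> (mset_set S) = image_mset \<psi> (mset_set S)"
  proof (rule multiset_eqI)
    fix y
    have "count (image_mset \<chi> (mset_set S)) y = card {x \<in> S. \<chi> x = y}" for \<chi> :: "'a \<Rightarrow> 'b"
      using assms(1) by (simp add: count_image_mset' Collect_conj_eq eq_commute[of y])
    then show "count (image_mset \<phi> (mset_set S)) y = count (image_mset \<psi> (mset_set S)) y"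
      using assms(2) by simp
  qed
  then have "image_mset f (image_mset \<phi> (mset_set S)) = image_mset f (image_mset \<psi> (mset_set S))"
    by simp
  then show ?thesis
    by (simp add: sum_unfold_sum_mset multiset.map_comp comp_def)
qed

text \<open>The counts in the definition are the fibre sizes of the map from \<open>u\<close> to its
  pair of distances. Matrix products, degrees and edge energies all use distance-regularity in this
  form.\<close>

lemma distance_regular_sum:
  fixes f :: "nat \<Rightarrow> nat \<Rightarrow> 'a :: comm_monoid_add"
  assumes "distance_regular n E" "i < n" "j < n" "i' < n" "j' < n"
    and "graph_dist E i j = graph_dist E i' j'"
  shows "(\<Sum>u<n. f (graph_dist E u i) (graph_dist E u j)) =
    (\<Sum>u<n. f (graph_dist E u i') (graph_dist E u j'))"
proof -
  let ?\<phi> = "\<lambda>i j u. (graph_dist E u i, graph_dist E u j)"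
  have "card {u \<in> {..<n}. ?\<phi> i j u = y} = card {u \<in> {..<n}. ?\<phi> i' j' u = y}" for y
  proof (cases y)
    case (Pair p q)
    have "card {u. u < n \<and> graph_dist E u i = p \<and> graph_dist E u j = q} =
        card {u. u < n \<and> graph_dist E u i' = p \<and> graph_dist E u j' = q}"
      using assms unfolding distance_regular_def by blast
    then show ?thesis
      by (simp only: Pair prod.inject lessThan_iff)
  qed
  from sum_cong_fibre_card[OF _ this, of "\<lambda>y. f (fst y) (snd y)"] show ?thesis
    by simp
qed

section \<open>Matrices depending on the distance only\<close>

text \<open>For a distance-regular graph the square matrices of this kind form its Bose-Mesner
  algebra.\<close>

definition distance_matrix :: "nat \<Rightarrow> nat set set \<Rightarrow> 'a mat \<Rightarrow> bool" where
  "distance_matrix n E M \<longleftrightarrow> (\<exists>g. \<forall>i<n. \<forall>j<n. M $$ (i,j) = g (graph_dist E i j))"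

lemma distance_matrix_mult:
  fixes M N :: "'a :: comm_semiring_0 mat"
  assumes dr: "distance_regular n E"
    and M: "M \<in> carrier_mat n n" "distance_matrix n E M"
    and N: "N \<in> carrier_mat n n" "distance_matrix n E N"
  shows "distance_matrix n E (M * N)"
proof -
  obtain g h where g: "\<And>i j. i < n \<Longrightarrow> j < n \<Longrightarrow> M $$ (i,j) = g (graph_dist E i j)"
    and h: "\<And>i j. i < n \<Longrightarrow> j < n \<Longrightarrow> N $$ (i,j) = h (graph_dist E i j)"
    using M N unfolding distance_matrix_def by blast
  have entry: "(M * N) $$ (i,j) = (\<Sum>u<n. g (graph_dist E u i) * h (graph_dist E u j))"
    if "i < n" "j < n" for i j
    using that M N
    by (auto simp: scalar_prod_def atLeast0LessThan g h graph_dist_sym[of E i] intro!: sum.cong)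
  \<comment> \<open>\<open>k\<close> reads off the entry at some pair at distance \<open>d\<close>;
    by \<open>distance_regular_sum\<close> the choice of the pair does not matter.\<close>
  define k where "k d = (SOME x. \<exists>i<n. \<exists>j<n. graph_dist E i j = d \<and> x = (M * N) $$ (i,j))" for d
  have "(M * N) $$ (i,j) = k (graph_dist E i j)" if ij: "i < n" "j < n" for i j
  proof -
    have "\<exists>i'<n. \<exists>j'<n. graph_dist E i' j' = graph_dist E i j \<and> k (graph_dist E i j) = (M * N) $$ (i',j')"
      unfolding k_def by (rule someI_ex) (use ij in blast)
    then obtain i' j' where ij': "i' < n" "j' < n" "graph_dist E i j = graph_dist E i' j'"
      and k: "k (graph_dist E i j) = (M * N) $$ (i',j')"
      by auto
    show ?thesis
      unfolding k entry[OF ij] entry[OF ij'(1,2)] by (rule distance_regular_sum[OF dr ij ij'])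
  qed
  then show ?thesis
    unfolding distance_matrix_def by blast
qed

section \<open>The weighted Laplacian\<close>

text \<open>Extending the weight by zero to all ordered pairs turns edge sums into plain double
  sums. Each edge is counted twice, whence the factors 2 below.\<close>

definition edge_weight :: "nat set set \<Rightarrow> (nat set \<Rightarrow> real) \<Rightarrow> nat \<Rightarrow> nat \<Rightarrow> real" where
  "edge_weight E w i j = (if {i, j} \<in> E then w {i, j} else 0)"

lemma edge_weight_sym: "edge_weight E w i j = edge_weight E w j i"
  by (simp add: edge_weight_def insert_commute)

lemma laplacian_carrier: "laplacian n E w \<in> carrier_mat n n"
  by (simp add: laplacian_def)

lemma laplacian_symmetric: "(laplacian n E w)\<^sup>T = laplacian n E w"
  by (rule eq_matI) (auto simp: laplacian_def insert_commute)

lemma laplacian_mult_vec: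
  assumes "simple_graph n E" "x \<in> carrier_vec n" "i < n"
  shows "(laplacian n E w *\<^sub>v x) $ i = (\<Sum>j<n. edge_weight E w i j * (x $ i - x $ j))"
proof -
  let ?a = "edge_weight E w"
  have deg: "(\<Sum>k | k < n \<and> {i, k} \<in> E. w {i, k}) = (\<Sum>k<n. ?a i k)"
    unfolding edge_weight_def by (subst sum.inter_filter[symmetric]) auto
  have "(laplacian n E w *\<^sub>v x) $ i = (\<Sum>j<n. laplacian n E w $$ (i,j) * x $ j)"
    using assms by (auto simp: scalar_prod_def laplacian_def atLeast0LessThan intro!: sum.cong)
  \<comment> \<open>Without loops \<open>edge_weight\<close> vanishes at \<open>j = i\<close>, so
    the diagonal term is the degree alone.\<close>
  also have "\<dots> = (\<Sum>j<n. (if i = j then (\<Sum>k<n. ?a i k) * x $ i else 0) - ?a i j * x $ j)"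
    by (rule sum.cong)
      (use assms no_loop[OF assms(1)] deg in \<open>auto simp: laplacian_def edge_weight_def\<close>)
  also have "\<dots> = (\<Sum>j<n. ?a i j * (x $ i - x $ j))"
    using assms by (simp add: sum_subtractf sum_distrib_right right_diff_distrib)
  finally show ?thesis .
qed

lemma laplacian_ones:
  assumes "simple_graph n E"
  shows "laplacian n E w *\<^sub>v vec n (\<lambda>_. 1) = 0\<^sub>v n"
  by (rule eq_vecI) (use assms laplacian_carrier[of n E w] in \<open>auto simp: laplacian_mult_vec simp del: index_mult_mat_vec\<close>)

text \<open>Exchanging the two indices and adding completes the square:
  \<open>x $ i * (x $ i - x $ j)\<close> and its mirror image sum to
  \<open>(x $ i - x $ j)\<^sup>2\<close>.\<close>

lemma laplacian_quadratic_form: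
  assumes "simple_graph n E" "x \<in> carrier_vec n"
  shows "x \<bullet> (laplacian n E w *\<^sub>v x) =
    (\<Sum>i<n. \<Sum>j<n. edge_weight E w i j * (x $ i - x $ j)\<^sup>2) / 2"
proof -
  let ?a = "edge_weight E w"
  let ?S = "\<Sum>i<n. \<Sum>j<n. ?a i j * (x $ i * (x $ i - x $ j))"
  have "x \<bullet> (laplacian n E w *\<^sub>v x) = (\<Sum>i<n. x $ i * (laplacian n E w *\<^sub>v x) $ i)"
    using laplacian_carrier[of n E w] unfolding scalar_prod_def atLeast0LessThan by simp
  also have "\<dots> = ?S"
    using assms by (simp add: laplacian_mult_vec sum_distrib_left mult_ac del: index_mult_mat_vec)
  finally have S: "x \<bullet> (laplacian n E w *\<^sub>v x) = ?S" .
  have "?S = (\<Sum>i<n. \<Sum>j<n. ?a i j * (x $ j * (x $ j - x $ i)))"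
    by (subst sum.swap) (simp add: edge_weight_sym[of E w])
  then have "2 * ?S = ?S + (\<Sum>i<n. \<Sum>j<n. ?a i j * (x $ j * (x $ j - x $ i)))"
    by simp
  also have "\<dots> = (\<Sum>i<n. \<Sum>j<n. ?a i j * (x $ i - x $ j)\<^sup>2)"
    unfolding sum.distrib[symmetric]
    by (intro sum.cong) (auto simp: power2_eq_square algebra_simps)
  finally show ?thesis
    unfolding S by simp
qed

lemma laplacian_psd:
  assumes "simple_graph n E" "\<And>e. e \<in> E \<Longrightarrow> 0 \<le> w e" "x \<in> carrier_vec n"
  shows "0 \<le> x \<bullet> (laplacian n E w *\<^sub>v x)"
  unfolding laplacian_quadratic_form[OF assms(1,3)]
  by (auto intro!: divide_nonneg_pos sum_nonneg simp: edge_weight_def assms(2))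

text \<open>Each edge is the image of exactly two ordered pairs.\<close>

lemma sum_edge_weight:
  assumes "simple_graph n E"
  shows "(\<Sum>i<n. \<Sum>j<n. edge_weight E w i j) = 2 * (\<Sum>e\<in>E. w e)"
proof -
  define P where "P = {(i,j). i < n \<and> j < n \<and> {i,j} \<in> E}"
  define f where "f p = {fst p, snd p}" for p :: "nat \<times> nat"
  have P_sub: "P \<subseteq> {..<n} \<times> {..<n}"
    by (auto simp: P_def)
  then have "finite P"
    using finite_subset by blast
  have fP: "f ` P = E"
  proof
    show "E \<subseteq> f ` P"
    proof
      fix e assume "e \<in> E"
      then obtain u v where "u < n" "v < n" "e = {u,v}"
        using assms by (auto simp: simple_graph_def)
      then show "e \<in> f ` P"
        using \<open>e \<in> E\<close> by (intro image_eqI[of _ _ "(u,v)"]) (auto simp: f_def P_def)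
    qed
  qed (auto simp: f_def P_def)
  have fibre: "(\<Sum>p | p \<in> P \<and> f p = e. w (f p)) = 2 * w e" if "e \<in> E" for e
  proof -
    obtain u v where uv: "u < n" "v < n" "e = {u,v}" "u \<noteq> v"
      using assms \<open>e \<in> E\<close> by (auto simp: simple_graph_def)
    then have "{p. p \<in> P \<and> f p = e} = {(u,v), (v,u)}"
      using that by (auto simp: P_def f_def doubleton_eq_iff insert_commute)
    then show ?thesis
      using uv by (simp add: f_def insert_commute)
  qed
  have "(\<Sum>i<n. \<Sum>j<n. edge_weight E w i j) = (\<Sum>p\<in>{..<n} \<times> {..<n}. edge_weight E w (fst p) (snd p))"
    by (simp add: sum.cartesian_product case_prod_unfold)
  also have "\<dots> = (\<Sum>p\<in>P. w (f p))"
    by (rule sum.mono_neutral_cong_right) (use P_sub in \<open>auto simp: P_def f_def edge_weight_def\<close>)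
  also have "\<dots> = (\<Sum>e\<in>E. \<Sum>p | p \<in> P \<and> f p = e. w (f p))"
    using sum.image_gen[OF \<open>finite P\<close>, of "\<lambda>p. w (f p)" f] by (simp add: fP)
  also have "\<dots> = 2 * (\<Sum>e\<in>E. w e)"
    unfolding sum_distrib_left by (rule sum.cong) (simp_all only: fibre)
  finally show ?thesis .
qed

text \<open>Off the diagonal only adjacency matters, which is distance 1. On it stands the degree,
  the number of vertices at distance 1, so the graph has to be shown regular.\<close>

lemma distance_matrix_laplacian_shift:
  assumes dr: "distance_regular n E"
  shows "distance_matrix n E (laplacian n E (\<lambda>_. 1) - \<mu> \<cdot>\<^sub>m 1\<^sub>m n)"
proof -
  have conn: "connected_graph n E"
    using dr by (simp add: distance_regular_def)
  define deg where "deg i = (\<Sum>k | k < n \<and> {i, k} \<in> E. 1 :: real)" for i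
  have deg: "deg i = (\<Sum>u<n. if graph_dist E u i = 1 then 1 else 0)" if i: "i < n" for i
  proof -
    have "graph_dist E k i = 1 \<longleftrightarrow> {i, k} \<in> E" if "k < n" for k
      using graph_dist_eq_1_iff[OF conn that i] by (metis insert_commute)
    then have "{k. k < n \<and> {i, k} \<in> E} = {k \<in> {..<n}. graph_dist E k i = 1}"
      by (metis (lifting) lessThan_iff)
    then show ?thesis
      unfolding deg_def by (simp only: sum.inter_filter finite_lessThan)
  qed
  have "deg i = deg 0" if "i < n" for i
  proof -
    have "graph_dist E i i = graph_dist E 0 0"
      using graph_dist_eq_0_iff[OF conn, of i i] graph_dist_eq_0_iff[OF conn, of 0 0] that by simp
    then show ?thesis
      \<comment> \<open>The pairs \<open>(i, i)\<close> and \<open>(0, 0)\<close> both have distance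
        0, and the summand counts the vertices at distance 1.\<close>
      using distance_regular_sum[OF dr, of i i 0 0 "\<lambda>p q. if p = 1 then 1 else 0"] that
      by (simp add: deg)
  qed
  then have const: "deg i = deg 0" if "i < n" for i
    using that by blast
  define g where "g d = (if d = 0 then deg 0 - \<mu> else if d = 1 then - 1 else 0)" for d :: nat
  have "(laplacian n E (\<lambda>_. 1) - \<mu> \<cdot>\<^sub>m 1\<^sub>m n) $$ (i,j) =
      g (graph_dist E i j)"
    if ij: "i < n" "j < n" for i j
  proof -
    have "laplacian n E (\<lambda>_. 1) $$ (i,j) = (if i = j then deg i else if {i, j} \<in> E then - 1 else 0)"
      unfolding laplacian_def deg_def using ij by (simp only: index_mat split)
    moreover have "(laplacian n E (\<lambda>_. 1) - \<mu> \<cdot>\<^sub>m 1\<^sub>m n) $$ (i,j) =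
        laplacian n E (\<lambda>_. 1) $$ (i,j) - (if i = j then \<mu> else 0)"
      using ij by simp
    ultimately show ?thesis
      by (simp only: g_def const[OF ij(1)] graph_dist_eq_0_iff[OF conn ij] graph_dist_eq_1_iff[OF conn ij])
        simp
  qed
  then show ?thesis
    unfolding distance_matrix_def by (intro exI[of _ g] allI impI)
qed

lemma distance_matrix_one:
  assumes "connected_graph n E"
  shows "distance_matrix n E (1\<^sub>m n)"
  unfolding distance_matrix_def
proof (intro exI allI impI)
  fix i j assume "i < n" "j < n"
  then show "1\<^sub>m n $$ (i,j) = (\<lambda>d. if d = 0 then 1 else 0) (graph_dist E i j)"
    using graph_dist_eq_0_iff[OF assms, of i j] by simp
qed

section \<open>Conformal rigidity\<close>

lemma laplacian_eigenbasis:
  obtains U es where "eigenbasis n (laplacian n E w) U es"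
  using ex_eigenbasis[OF laplacian_carrier laplacian_symmetric] .

lemma lap_eigenvalue_bounds:
  assumes n: "2 \<le> n" and sg: "simple_graph n E" and w: "\<And>e. e \<in> E \<Longrightarrow> 0 \<le> w e"
    and x: "x \<in> carrier_vec n" "x \<bullet> vec n (\<lambda>_. 1) = 0"
  shows "lap_eigenvalue 2 n E w * (x \<bullet> x) \<le> x \<bullet> (laplacian n E w *\<^sub>v x)"
    and "x \<bullet> (laplacian n E w *\<^sub>v x) \<le> lap_eigenvalue n n E w * (x \<bullet> x)"
proof -
  obtain U es where eb: "eigenbasis n (laplacian n E w) U es"
    by (rule laplacian_eigenbasis)
  have "vec n (\<lambda>_. 1 :: real) $ 0 \<noteq> 0\<^sub>v n $ 0"
    using n by simp
  then have "vec n (\<lambda>_. 1 :: real) \<noteq> 0\<^sub>v n"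
    by metis
  then have "es ! 1 * (x \<bullet> x) \<le> x \<bullet> (laplacian n E w *\<^sub>v x)"
    using eigenbasis.rayleigh_lower[OF eb laplacian_psd[OF sg w] _ _ laplacian_ones[OF sg] x n]
    by simp
  then show "lap_eigenvalue 2 n E w * (x \<bullet> x) \<le> x \<bullet> (laplacian n E w *\<^sub>v x)"
    by (simp add: lap_eigenvalue_def eigenbasis.nth_eigenvalue[OF eb])
  show "x \<bullet> (laplacian n E w *\<^sub>v x) \<le> lap_eigenvalue n n E w * (x \<bullet> x)"
    using eigenbasis.rayleigh_upper[OF eb x(1)]
    by (simp add: lap_eigenvalue_def eigenbasis.nth_eigenvalue[OF eb])
qed

text \<open>A vanishing sum of squares forces equal values across each edge, hence along every
  walk.\<close>

lemma laplacian_form_zero_constant: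
  assumes conn: "connected_graph n E" and x: "x \<in> carrier_vec n"
    and zero: "x \<bullet> (laplacian n E (\<lambda>_. 1) *\<^sub>v x) = 0" and i: "i < n"
  shows "x $ i = x $ 0"
proof -
  let ?t = "\<lambda>i j. edge_weight E (\<lambda>_. 1) i j * (x $ i - x $ j)\<^sup>2"
  have sg: "simple_graph n E"
    using conn by (simp add: connected_graph_def)
  have "(\<Sum>i<n. \<Sum>j<n. ?t i j) = 0"
    using laplacian_quadratic_form[OF sg x, of "\<lambda>_. 1"] zero by simp
  moreover have "0 \<le> ?t i j" for i j
    by (simp add: edge_weight_def)
  ultimately have t0: "?t i j = 0" if "i < n" "j < n" for i j
    using that by (simp add: sum_nonneg_eq_0_iff sum_nonneg)
  have edge: "x $ i = x $ j" if "{i, j} \<in> E" for i j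
  proof -
    have "i < n" "j < n"
      using that sg by (auto simp: simple_graph_def doubleton_eq_iff)
    from t0[OF this] show ?thesis
      using that by (simp add: edge_weight_def)
  qed
  have "(0, i) \<in> (adj E)\<^sup>*"
    using conn i by (simp add: connected_graph_def)
  then show ?thesis
    by induction (auto simp: adj_iff dest: edge)
qed

text \<open>Otherwise the first two basis vectors both have zero energy and are constant, but two
  nonzero constant vectors are not orthogonal.\<close>

lemma second_eigenvalue_pos:
  assumes n: "2 \<le> n" and conn: "connected_graph n E"
    and eb: "eigenbasis n (laplacian n E (\<lambda>_. 1)) U es"
  shows "0 < es ! 1"
proof (rule ccontr)
  interpret eigenbasis n "laplacian n E (\<lambda>_. 1)" U es
    by (rule eb)
  assume neg: "\<not> 0 < es ! 1"
  have sg: "simple_graph n E"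
    using conn by (simp add: connected_graph_def)
  have const: "col U i $ k = col U i $ 0" if i: "i \<le> 1" and k: "k < n" for i k
  proof (rule laplacian_form_zero_constant[OF conn _ _ k])
    have "i < n" "es ! i \<le> 0"
      using i n neg nth_mono[of i 1] by auto
    then show "col U i \<in> carrier_vec n"
      by (simp add: col_carrier)
    then have "0 \<le> col U i \<bullet> (laplacian n E (\<lambda>_. 1) *\<^sub>v col U i)"
      using laplacian_psd[OF sg, of "\<lambda>_. 1"] by simp
    then show "col U i \<bullet> (laplacian n E (\<lambda>_. 1) *\<^sub>v col U i) = 0"
      using rayleigh_col[OF \<open>i < n\<close>] \<open>es ! i \<le> 0\<close> by simp
  qed
  have prod: "col U i \<bullet> col U j = real n * (col U i $ 0 * col U j $ 0)" if "i \<le> 1" "j \<le> 1" for i j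
  proof -
    have "col U i \<bullet> col U j = (\<Sum>k<n. col U i $ k * col U j $ k)"
      using U by (simp add: scalar_prod_def atLeast0LessThan)
    also have "\<dots> = (\<Sum>k<n. col U i $ 0 * col U j $ 0)"
      by (intro sum.cong refl arg_cong2[of _ _ _ _ "(*)"] const that) simp_all
    finally show ?thesis
      by simp
  qed
  have "col U 0 $ 0 * col U 1 $ 0 = 0" "col U 0 $ 0 \<noteq> 0" "col U 1 $ 0 \<noteq> 0"
    using prod[of 0 1] prod[of 0 0] prod[of 1 1] n
      col_orthonormal[of 0 1] col_orthonormal[of 0 0] col_orthonormal[of 1 1]
    by (auto simp del: index_col)
  then show False
    by simp
qed

text \<open>On the columns of \<open>F\<close>, the sum of the quadratic forms depends only on the total weight, since
  the sum over \<open>j\<close> of \<open>(F\<^sub>u\<^sub>j - F\<^sub>v\<^sub>j)\<^sup>2\<close> is the same for all edges \<open>{u, v}\<close>.\<close>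
lemma distance_matrix_energy:
  fixes F :: "real mat"
  assumes dr: "distance_regular n E" and F: "F \<in> carrier_mat n n" "distance_matrix n E F"
  obtains C where "\<And>w. (\<Sum>j<n. col F j \<bullet> (laplacian n E w *\<^sub>v col F j)) = C * (\<Sum>e\<in>E. w e)"
proof -
  have conn: "connected_graph n E" and sg: "simple_graph n E"
    using dr by (auto simp: distance_regular_def connected_graph_def)
  obtain g where g: "\<And>i j. i < n \<Longrightarrow> j < n \<Longrightarrow> F $$ (i,j) = g (graph_dist E i j)"
    using F(2) unfolding distance_matrix_def by blast
  define s where "s u v = (\<Sum>j<n. (F $$ (u,j) - F $$ (v,j))\<^sup>2)" for u v
  have s: "s u v = (\<Sum>j<n. (g (graph_dist E j u) - g (graph_dist E j v))\<^sup>2)"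
    if "u < n" "v < n" for u v
    unfolding s_def using that
    by (auto simp: g graph_dist_sym[of E u] graph_dist_sym[of E v] intro!: sum.cong)
  have "s u v = s u' v'"
    if "u < n" "v < n" "u' < n" "v' < n" "{u, v} \<in> E" "{u', v'} \<in> E" for u v u' v'
  proof -
    have "graph_dist E u v = graph_dist E u' v'"
      using that graph_dist_eq_1_iff[OF conn] by metis
    from distance_regular_sum[OF dr that(1-4) this] show ?thesis
      unfolding s[OF that(1,2)] s[OF that(3,4)] .
  qed
  \<comment> \<open>All edges share the value \<open>C\<close>; in a graph without edges any number
    will do.\<close>
  then obtain C where C: "\<And>u v. u < n \<Longrightarrow> v < n \<Longrightarrow> {u, v} \<in> E \<Longrightarrow> s u v = C"
    by metis
  have "(\<Sum>j<n. col F j \<bullet> (laplacian n E w *\<^sub>v col F j)) = C * (\<Sum>e\<in>E. w e)" for w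
  proof -
    have "(\<Sum>j<n. col F j \<bullet> (laplacian n E w *\<^sub>v col F j)) =
        (\<Sum>j<n. \<Sum>u<n. \<Sum>v<n. edge_weight E w u v * (F $$ (u,j) - F $$ (v,j))\<^sup>2) / 2"
    proof (subst sum_divide_distrib, rule sum.cong)
      fix j assume "j \<in> {..<n}"
      then have "col F j \<in> carrier_vec n" "\<And>u. u < n \<Longrightarrow> col F j $ u = F $$ (u,j)"
        using F(1) by auto
      then show "col F j \<bullet> (laplacian n E w *\<^sub>v col F j) =
          (\<Sum>u<n. \<Sum>v<n. edge_weight E w u v * (F $$ (u,j) - F $$ (v,j))\<^sup>2) / 2"
        by (simp add: laplacian_quadratic_form[OF sg])
    qed simp
    also have "(\<Sum>j<n. \<Sum>u<n. \<Sum>v<n. edge_weight E w u v * (F $$ (u,j) - F $$ (v,j))\<^sup>2) =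
        (\<Sum>u<n. \<Sum>v<n. edge_weight E w u v * s u v)"
      unfolding s_def sum_distrib_left
      by (subst sum.swap) (intro sum.cong refl sum.swap)
    \<comment> \<open>Replacing \<open>s u v\<close> by \<open>C\<close> is correct for every pair,
      since off the edges both terms carry the factor zero.\<close>
    also have "\<dots> = (\<Sum>u<n. \<Sum>v<n. C * edge_weight E w u v)"
      by (intro sum.cong refl) (auto simp: edge_weight_def C)
    also have "\<dots> = C * (2 * (\<Sum>e\<in>E. w e))"
      unfolding sum_edge_weight[OF sg, symmetric] by (simp only: sum_distrib_left)
    finally show ?thesis
      by simp
  qed
  then show thesis
    using that by blast
qed

text \<open>A single column of \<open>F\<close> may have a Rayleigh quotient for \<open>w\<close>
  different from \<open>l\<close>. Only the sums over all columns have ratio exactly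
  \<open>l\<close>, so the bounds are added up before comparing.\<close>

lemma lap_eigenvalue_between:
  assumes n: "2 \<le> n" and dr: "distance_regular n E" and w: "normalized_weight E w"
    and eb: "eigenbasis n (laplacian n E (\<lambda>_. 1)) U es"
    and l: "l \<in> set es" "l \<noteq> 0"
  shows "lap_eigenvalue 2 n E w \<le> l" and "l \<le> lap_eigenvalue n n E w"
proof -
  let ?L = "laplacian n E"
  have conn: "connected_graph n E" and sg: "simple_graph n E"
    using dr by (auto simp: distance_regular_def connected_graph_def)
  note L = laplacian_carrier[of n E]
  have step: "distance_matrix n E ((?L (\<lambda>_. 1) - \<mu> \<cdot>\<^sub>m 1\<^sub>m n) * M)"
    if "M \<in> carrier_mat n n" "distance_matrix n E M" for M \<mu>
    by (rule distance_matrix_mult[OF dr _ distance_matrix_laplacian_shift[OF dr] that])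
      (rule minus_carrier_mat, simp)
  obtain F where F: "F \<in> carrier_mat n n" "distance_matrix n E F" "?L (\<lambda>_. 1) * F = l \<cdot>\<^sub>m F" "F \<noteq> 0\<^sub>m n n"
    using eigenbasis.eigenspace_polynomial[OF eb distance_matrix_one[OF conn] step l(1)] by blast
  let ?x = "col F"
  let ?one = "vec n (\<lambda>_. 1 :: real)"
  have x: "?x j \<in> carrier_vec n" if "j < n" for j
    using that F by simp
  have Lx: "?L (\<lambda>_. 1) *\<^sub>v ?x j = l \<cdot>\<^sub>v ?x j" if "j < n" for j
    using that F(1) L arg_cong[OF F(3), of "\<lambda>M. col M j"] col_mult2[OF L F(1) that]
    by simp
  have perp: "?x j \<bullet> ?one = 0" if "j < n" for j
  proof -
    \<comment> \<open>Moving the symmetric Laplacian onto the all-ones vector, which lies in its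
      kernel, gives zero; this is where \<open>l\<close> must be nonzero.\<close>
    have "l * (?x j \<bullet> ?one) = (?L (\<lambda>_. 1) *\<^sub>v ?x j) \<bullet> ?one"
      using x[OF that] Lx[OF that] by simp
    also have "\<dots> = 0"
      using symmetric_scalar_prod[OF L laplacian_symmetric x[OF that], of ?one]
        laplacian_ones[OF sg] x[OF that] by simp
    finally show ?thesis
      using l by simp
  qed
  define T where "T = (\<Sum>j<n. ?x j \<bullet> ?x j)"
  obtain a b where ab: "a < n" "b < n" "F $$ (a,b) \<noteq> 0"
    using F(1,4) by (metis carrier_matD eq_matI index_zero_mat)
  have "?x b \<noteq> 0\<^sub>v n"
    using ab F(1) by (metis carrier_matD index_col index_zero_vec(1))
  then have "0 < ?x b \<bullet> ?x b"
    by (rule self_scalar_prod_pos[OF x[OF ab(2)]])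
  moreover have "0 \<le> ?x j \<bullet> ?x j" if "j < n" for j
    unfolding self_scalar_prod[OF x[OF that]] by (simp add: sum_nonneg)
  ultimately have "0 < T"
    unfolding T_def using ab(2) by (intro sum_pos2[of _ b]) auto
  obtain C where C: "\<And>w. (\<Sum>j<n. ?x j \<bullet> (?L w *\<^sub>v ?x j)) = C * (\<Sum>e\<in>E. w e)"
    using distance_matrix_energy[OF dr F(1,2)] by blast
  \<comment> \<open>\<open>C\<close> is the same for all weights, and \<open>w\<close> and the
    all-ones weight both have total \<open>card E\<close>, so their energies agree.\<close>
  have "(\<Sum>j<n. ?x j \<bullet> (?L w *\<^sub>v ?x j)) = (\<Sum>j<n. ?x j \<bullet> (?L (\<lambda>_. 1) *\<^sub>v ?x j))"
    unfolding C using w by (simp add: normalized_weight_def)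
  also have "\<dots> = l * T"
    using x by (simp add: T_def sum_distrib_left Lx)
  finally have energy: "(\<Sum>j<n. ?x j \<bullet> (?L w *\<^sub>v ?x j)) = l * T" .
  have w0: "\<And>e. e \<in> E \<Longrightarrow> 0 \<le> w e"
    using w by (simp add: normalized_weight_def)
  have "lap_eigenvalue 2 n E w * T \<le> l * T"
    unfolding energy[symmetric] unfolding T_def sum_distrib_left
    by (intro sum_mono lap_eigenvalue_bounds(1)[OF n sg w0]) (auto simp: x perp)
  then show "lap_eigenvalue 2 n E w \<le> l"
    using \<open>0 < T\<close> by simp
  have "l * T \<le> lap_eigenvalue n n E w * T"
    unfolding energy[symmetric] unfolding T_def sum_distrib_left
    by (intro sum_mono lap_eigenvalue_bounds(2)[OF n sg w0]) (auto simp: x perp)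
  then show "l \<le> lap_eigenvalue n n E w"
    using \<open>0 < T\<close> by simp
qed

theorem theorem2:
  fixes n :: nat and E :: "nat set set"
  assumes "2 \<le> n"
    and "distance_regular n E"
  shows "conformally_rigid n E"
proof -
  obtain U es where eb: "eigenbasis n (laplacian n E (\<lambda>_. 1)) U es"
    by (rule laplacian_eigenbasis)
  have len: "length es = n"
    using eb by (simp add: eigenbasis_def)
  have eigenvalue: "lap_eigenvalue k n E (\<lambda>_. 1) = es ! (k - 1)" for k
    by (simp add: lap_eigenvalue_def eigenbasis.nth_eigenvalue[OF eb])
  \<comment> \<open>Positivity makes \<open>es ! 1\<close>, and with it \<open>es ! (n - 1)\<close>,
    a nonzero eigenvalue, as \<open>lap_eigenvalue_between\<close> demands.\<close>
  have pos: "0 < es ! 1"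
    using second_eigenvalue_pos[OF assms(1) _ eb] assms(2) by (simp add: distance_regular_def)
  moreover have le: "es ! 1 \<le> es ! (n - 1)"
    using eigenbasis.nth_mono[OF eb] assms(1) by simp
  moreover have "es ! 1 \<in> set es" "es ! (n - 1) \<in> set es"
    using assms(1) len by simp_all
  ultimately show ?thesis
    using lap_eigenvalue_between[OF assms _ eb]
    unfolding conformally_rigid_def eigenvalue by auto
qed

end
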